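(* Let $d$ be a positive integer, let $\Sigma$ be a nonsingular $d\times d$ covariance matrix, let $(X_1,\ldots,X_d)\sim\mathcal{N}_d(0,\Sigma)$, and let $n_1,\ldots,n_d\in(0,1)$ be real numbers. Then for every $I\subset\{1,\ldots,d\}$, with $I^c=\{1,\ldots,d\}\setminus I$, $$\mathbb{E}\Big(\prod_{j=1}^d|X_j|^{-n_j}\Big)\ \ge\ \mathbb{E}\Big(\prod_{j\in I}|X_j|^{-n_j}\Big)\cdot\mathbb{E}\Big(\prod_{j\in I^c}|X_j|^{-n_j}\Big).$$
   Context: $\mathcal{N}_d(0,\Sigma)$ denotes the centered $d$-dimensional Gaussian distribution with covariance matrix $\Sigma$. Empty products equal $1$. *)

theory Defs
  imports "HOL-Probability.Probability"
begin

text \<open>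
  A matrix is the covariance matrix of some (square-integrable) random vector iff it is symmetric
  and positive semidefinite.
\<close>

definition covariance_matrix :: "real ^ 'd ^ 'd \<Rightarrow> bool" where
  "covariance_matrix S \<longleftrightarrow> transpose S = S \<and> (\<forall>v. 0 \<le> v \<bullet> (S *v v))"

text \<open>
  Lebesgue density of the centered Gaussian distribution with covariance matrix \<open>S\<close>. It is
  meaningful only for invertible \<open>S\<close>; a singular covariance matrix has no such density.
\<close>

definition centered_gaussian_density :: "real ^ 'd ^ 'd \<Rightarrow> real ^ 'd \<Rightarrow> real" where
  "centered_gaussian_density S x =
     exp (- (x \<bullet> (matrix_inv S *v x)) / 2) / sqrt ((2 * pi) ^ CARD('d) * det S)"

end

theory Submission
  imports Defs "HOL-Complex_Analysis.Complex_Analysis"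
begin

text \<open>
  The Gaussian vector satisfies
  \<open>E cos (u \<bullet> X) * E cos (v \<bullet> X) \<le> E (cos (u \<bullet> X) * cos (v \<bullet> X))\<close>, because the product formula for
  cosines and the characteristic function \<open>exp (- (u \<bullet> S u) / 2)\<close> turn the ratio of the two sides into
  \<open>cosh (u \<bullet> S v) \<ge> 1\<close>. Such an inequality survives averaging each factor over its own parameters.
  Averaging \<open>u\<close> over independent normal coordinates turns the cosine into a product of functions
  \<open>exp (- t j * (x j)\<^sup>2)\<close>, and averaging these over \<open>t j\<close> with the weights of the Gamma integral gives
  the powers \<open>\<bar>x j\<bar> powr (- n j)\<close>.
\<close>

section \<open>Characteristic functions from exponential moments\<close>

text \<open>Integrating the exponential series term by term is justified by the majorant
  \<open>exp (norm z * \<bar>Y \<omega>\<bar>)\<close>, which is integrable because the exponential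
  moments exist in both real directions. The result is a power series in \<open>z\<close> that
  converges everywhere, so the transform is entire.\<close>

lemma expectation_exp_sums:
  fixes Y :: "'a \<Rightarrow> real" and z :: complex
  assumes Y [measurable]: "Y \<in> borel_measurable M"
    and exp_int: "\<And>s. integrable M (\<lambda>\<omega>. exp (s * Y \<omega>))"
  shows "(\<lambda>k. of_real (\<integral>\<omega>. Y \<omega> ^ k /\<^sub>R fact k \<partial>M) * z ^ k) sums (\<integral>\<omega>. exp (z * Y \<omega>) \<partial>M)"
proof -
  let ?f = "\<lambda>k \<omega>. (z * Y \<omega>) ^ k /\<^sub>R fact k"
  let ?g = "\<lambda>\<omega>. exp (norm z * \<bar>Y \<omega>\<bar>)"
  have norm_f: "norm (?f k \<omega>) = (norm z * \<bar>Y \<omega>\<bar>) ^ k /\<^sub>R fact k" for k \<omega>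
    by (simp add: norm_mult norm_power)
  \<comment> \<open>This bound serves twice: \<open>A = {k}\<close> gives integrability of each
    term, and \<open>A = {..<n}\<close> bounds the sums of the L1 norms uniformly in
    \<open>n\<close>.\<close>
  have partial: "(\<Sum>k\<in>A. norm (?f k \<omega>)) \<le> ?g \<omega>" if "finite A" for A \<omega>
    unfolding norm_f exp_def
    by (rule sum_le_suminf[OF summable_exp_generic]) (use that in auto)
  have g_int: "integrable M ?g"
  proof (rule Bochner_Integration.integrable_bound)
    show "integrable M (\<lambda>\<omega>. exp (norm z * Y \<omega>) + exp (- norm z * Y \<omega>))"
      by (intro Bochner_Integration.integrable_add exp_int)
    have "?g \<omega> \<le> exp (norm z * Y \<omega>) + exp (- norm z * Y \<omega>)" for \<omega>
      by (cases "Y \<omega> \<ge> 0") auto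
    then show "AE \<omega> in M. norm (?g \<omega>) \<le> norm (exp (norm z * Y \<omega>) + exp (- norm z * Y \<omega>))"
      by (intro AE_I2) (simp add: abs_of_pos add_pos_pos)
  qed simp
  have f_int: "integrable M (?f k)" for k
    using partial[of "{k}"]
    by (intro Bochner_Integration.integrable_bound[OF g_int]) auto
  have "(\<lambda>k. \<integral>\<omega>. ?f k \<omega> \<partial>M) sums (\<integral>\<omega>. (\<Sum>k. ?f k \<omega>) \<partial>M)"
  proof (rule sums_integral[OF f_int])
    show "AE \<omega> in M. summable (\<lambda>k. norm (?f k \<omega>))"
      unfolding norm_f by (intro AE_I2 summable_exp_generic)
    show "summable (\<lambda>k. \<integral>\<omega>. norm (?f k \<omega>) \<partial>M)"
    proof (rule summableI_nonneg_bounded)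
      fix n
      have "(\<Sum>k<n. \<integral>\<omega>. norm (?f k \<omega>) \<partial>M) = (\<integral>\<omega>. (\<Sum>k<n. norm (?f k \<omega>)) \<partial>M)"
        by (subst Bochner_Integration.integral_sum) (intro integrable_norm f_int refl)+
      also have "\<dots> \<le> (\<integral>\<omega>. ?g \<omega> \<partial>M)"
        by (intro integral_mono Bochner_Integration.integrable_sum integrable_norm f_int g_int partial) simp
      finally show "(\<Sum>k<n. \<integral>\<omega>. norm (?f k \<omega>) \<partial>M) \<le> (\<integral>\<omega>. ?g \<omega> \<partial>M)" .
    qed simp
  qed
  moreover have "(\<integral>\<omega>. ?f k \<omega> \<partial>M) = of_real (\<integral>\<omega>. Y \<omega> ^ k /\<^sub>R fact k \<partial>M) * z ^ k" for k
  proof -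
    have "?f k = (\<lambda>\<omega>. of_real (Y \<omega> ^ k /\<^sub>R fact k) * z ^ k)"
      by (auto simp: power_mult_distrib scaleR_conv_of_real)
    then show ?thesis
      by (simp only: integral_mult_left_zero integral_complex_of_real)
  qed
  ultimately show ?thesis
    by (simp add: exp_def)
qed

text \<open>Identity theorem: the expectation of \<open>exp (z * Y)\<close> and
  \<open>exp (c * z\<^sup>2 / 2)\<close> are entire in \<open>z\<close> and agree on the real line,
  hence also at \<open>\<i>\<close>, where the real part of the former is the expected
  cosine.\<close>

lemma expectation_cos_of_gaussian_mgf:
  fixes Y :: "'a \<Rightarrow> real"
  assumes Y: "Y \<in> borel_measurable M"
    and exp_int: "\<And>s. integrable M (\<lambda>\<omega>. exp (s * Y \<omega>))"
    and mgf: "\<And>s. (\<integral>\<omega>. exp (s * Y \<omega>) \<partial>M) = exp (c * s\<^sup>2 / 2)"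
  shows "(\<integral>\<omega>. cos (Y \<omega>) \<partial>M) = exp (- c / 2)"
proof -
  note [measurable] = Y
  define h where "h z = (\<integral>\<omega>. exp (z * complex_of_real (Y \<omega>)) \<partial>M) - exp (of_real c * z\<^sup>2 / 2)" for z
  \<comment> \<open>The expansion is valid at every \<open>z\<close>, so the radius \<open>r\<close>
    is arbitrary and the balls exhaust the plane.\<close>
  have "(\<lambda>z. \<integral>\<omega>. exp (z * complex_of_real (Y \<omega>)) \<partial>M) holomorphic_on ball 0 r" for r
    by (rule power_series_holomorphic) (use expectation_exp_sums[OF Y exp_int] in simp)
  then have "(\<lambda>z. \<integral>\<omega>. exp (z * complex_of_real (Y \<omega>)) \<partial>M) holomorphic_on UNIV"
    by (metis Elementary_Metric_Spaces.open_ball gt_ex holomorphic_on_def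
        holomorphic_on_imp_differentiable_at field_differentiable_at_within mem_ball)
  then have hol: "h holomorphic_on UNIV"
    unfolding h_def by (intro holomorphic_intros) auto
  have "h \<i> = 0"
  proof (rule analytic_continuation[OF hol, where U = "range of_real" and \<xi> = 0])
    show "(0::complex) islimpt range of_real"
      unfolding islimpt_approachable
    proof (intro allI impI)
      fix e :: real assume "e > 0"
      then show "\<exists>x'\<in>range of_real. x' \<noteq> (0::complex) \<and> dist x' 0 < e"
        by (intro bexI[of _ "of_real (e / 2)"] rangeI) auto
    qed
    fix z :: complex assume "z \<in> range of_real"
    then obtain s where z: "z = of_real s" by auto
    have "(\<integral>\<omega>. exp (z * complex_of_real (Y \<omega>)) \<partial>M) = (\<integral>\<omega>. complex_of_real (exp (s * Y \<omega>)) \<partial>M)"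
      unfolding z by (simp flip: exp_of_real)
    also have "\<dots> = exp (of_real c * z\<^sup>2 / 2)"
      by (simp only: integral_complex_of_real mgf) (simp add: z flip: exp_of_real)
    finally show "h z = 0" by (simp add: h_def)
  qed auto
  then have eq: "(\<integral>\<omega>. exp (\<i> * complex_of_real (Y \<omega>)) \<partial>M) = of_real (exp (- c / 2))"
    by (simp add: h_def flip: exp_of_real)
  \<comment> \<open>At \<open>s = 0\<close>, \<open>exp_int\<close> says that \<open>M\<close> is
    finite, so the constant 1 is an integrable majorant.\<close>
  have "integrable M (\<lambda>\<omega>. exp (\<i> * complex_of_real (Y \<omega>)))"
    by (rule Bochner_Integration.integrable_bound[where f = "\<lambda>\<omega>. 1::real"])
      (use exp_int[of 0] in \<open>auto simp: norm_exp_i_times\<close>)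
  then have "(\<integral>\<omega>. Re (exp (\<i> * complex_of_real (Y \<omega>))) \<partial>M) = exp (- c / 2)"
    by (subst integral_Re) (simp_all add: eq)
  then show ?thesis by (simp add: Re_exp)
qed

section \<open>Averaging correlation inequalities over a parameter\<close>

text \<open>Tonelli moves the integral over \<open>z\<close> outside, where \<open>corr\<close>
  applies for each \<open>z\<close>. The measure \<open>N\<close> is sigma-finite rather than finite
  so that the Gamma weights can be integrated against Lebesgue measure. Since \<open>g\<close> stays
  fixed, averaging both factors takes two applications.\<close>

lemma mixture_correlation_nn:
  fixes a :: "'b \<Rightarrow> 'a \<Rightarrow> ennreal"
  assumes "sigma_finite_measure N" "sigma_finite_measure M"
    and [measurable]: "(\<lambda>(z, \<omega>). a z \<omega>) \<in> borel_measurable (N \<Otimes>\<^sub>M M)"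
    and [measurable]: "g \<in> borel_measurable M"
    and corr: "\<And>z. z \<in> space N \<Longrightarrow> (\<integral>\<^sup>+\<omega>. a z \<omega> \<partial>M) * (\<integral>\<^sup>+\<omega>. g \<omega> \<partial>M) \<le> (\<integral>\<^sup>+\<omega>. a z \<omega> * g \<omega> \<partial>M)"
  shows "(\<integral>\<^sup>+\<omega>. (\<integral>\<^sup>+z. a z \<omega> \<partial>N) \<partial>M) * (\<integral>\<^sup>+\<omega>. g \<omega> \<partial>M) \<le> (\<integral>\<^sup>+\<omega>. (\<integral>\<^sup>+z. a z \<omega> \<partial>N) * g \<omega> \<partial>M)"
proof -
  interpret N: sigma_finite_measure N by fact
  interpret M: sigma_finite_measure M by fact
  interpret pair_sigma_finite N M by standard
  have "(\<integral>\<^sup>+\<omega>. (\<integral>\<^sup>+z. a z \<omega> \<partial>N) \<partial>M) * (\<integral>\<^sup>+\<omega>. g \<omega> \<partial>M)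
      = (\<integral>\<^sup>+z. (\<integral>\<^sup>+\<omega>. a z \<omega> \<partial>M) * (\<integral>\<^sup>+\<omega>. g \<omega> \<partial>M) \<partial>N)"
    by (subst Fubini') (simp_all add: nn_integral_multc)
  also have "\<dots> \<le> (\<integral>\<^sup>+z. (\<integral>\<^sup>+\<omega>. a z \<omega> * g \<omega> \<partial>M) \<partial>N)"
    by (intro nn_integral_mono corr)
  also have "\<dots> = (\<integral>\<^sup>+\<omega>. (\<integral>\<^sup>+z. a z \<omega> \<partial>N) * g \<omega> \<partial>M)"
  proof (subst Fubini'[symmetric])
    show "(\<integral>\<^sup>+\<omega>. (\<integral>\<^sup>+z. a z \<omega> * g \<omega> \<partial>N) \<partial>M) = (\<integral>\<^sup>+\<omega>. (\<integral>\<^sup>+z. a z \<omega> \<partial>N) * g \<omega> \<partial>M)"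
      by (intro nn_integral_cong nn_integral_multc) simp
  qed simp
  finally show ?thesis .
qed

text \<open>Signed counterpart for cosines: boundedness by 1 over probability measures supplies the
  integrability that Fubini requires.\<close>

lemma mixture_correlation:
  fixes a :: "'b \<Rightarrow> 'a \<Rightarrow> real"
  assumes "prob_space N" "prob_space M"
    and [measurable]: "(\<lambda>(z, \<omega>). a z \<omega>) \<in> borel_measurable (N \<Otimes>\<^sub>M M)"
    and [measurable]: "g \<in> borel_measurable M"
    and a: "\<And>z \<omega>. \<bar>a z \<omega>\<bar> \<le> 1" and g: "\<And>\<omega>. \<bar>g \<omega>\<bar> \<le> 1"
    and corr: "\<And>z. z \<in> space N \<Longrightarrow> (\<integral>\<omega>. a z \<omega> \<partial>M) * (\<integral>\<omega>. g \<omega> \<partial>M) \<le> (\<integral>\<omega>. a z \<omega> * g \<omega> \<partial>M)"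
  shows "(\<integral>\<omega>. (\<integral>z. a z \<omega> \<partial>N) \<partial>M) * (\<integral>\<omega>. g \<omega> \<partial>M) \<le> (\<integral>\<omega>. (\<integral>z. a z \<omega> \<partial>N) * g \<omega> \<partial>M)"
proof -
  interpret N: prob_space N by fact
  interpret M: prob_space M by fact
  interpret NM: pair_prob_space N M by standard
  have int_a: "integrable (N \<Otimes>\<^sub>M M) (\<lambda>(z, \<omega>). a z \<omega>)"
    by (rule NM.integrable_const_bound[where B = 1]) (use a in auto)
  have int_ag: "integrable (N \<Otimes>\<^sub>M M) (\<lambda>(z, \<omega>). a z \<omega> * g \<omega>)"
    by (rule NM.integrable_const_bound[where B = 1])
      (use a g in \<open>auto simp: abs_mult intro!: AE_I2 mult_le_one\<close>)
  have "(\<integral>\<omega>. (\<integral>z. a z \<omega> \<partial>N) \<partial>M) * (\<integral>\<omega>. g \<omega> \<partial>M)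
      = (\<integral>z. (\<integral>\<omega>. a z \<omega> \<partial>M) * (\<integral>\<omega>. g \<omega> \<partial>M) \<partial>N)"
    by (subst NM.Fubini_integral[OF int_a]) simp
  also have "\<dots> \<le> (\<integral>z. (\<integral>\<omega>. a z \<omega> * g \<omega> \<partial>M) \<partial>N)"
    using NM.integrable_fst[OF int_a] NM.integrable_fst[OF int_ag]
    by (intro integral_mono corr integrable_mult_left) auto
  also have "\<dots> = (\<integral>\<omega>. (\<integral>z. a z \<omega> \<partial>N) * g \<omega> \<partial>M)"
    by (subst NM.Fubini_integral[OF int_ag, symmetric]) simp
  finally show ?thesis .
qed

section \<open>The Gaussian law: exponential moments and null hyperplanes\<close>

lemma borel_measurable_vec_nth [measurable (raw)]:
  fixes f :: "'a \<Rightarrow> real ^ 'd"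
  assumes "f \<in> borel_measurable M"
  shows "(\<lambda>x. f x $ j) \<in> borel_measurable M"
  using assms by (simp add: cart_eq_inner_axis)

lemma covariance_matrix_symmetric:
  assumes "covariance_matrix S"
  shows "(S *v u) \<bullet> v = u \<bullet> (S *v v)"
  using assms unfolding covariance_matrix_def
  by (metis dot_lmul_matrix vector_transpose_matrix)

lemma matrix_inv_inverse:
  fixes S :: "real ^ 'd ^ 'd"
  assumes "invertible S"
  shows "S ** matrix_inv S = mat 1" "matrix_inv S ** S = mat 1"
proof -
  have "S ** matrix_inv S = mat 1 \<and> matrix_inv S ** S = mat 1"
    unfolding matrix_inv_def by (rule someI_ex) (use assms in \<open>simp add: invertible_def\<close>)
  then show "S ** matrix_inv S = mat 1" "matrix_inv S ** S = mat 1" by auto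
qed

text \<open>Completing the square: the shift by \<open>S *v u\<close> produces the cross term
  \<open>2 * (u \<bullet> x)\<close> in the quadratic form, which after halving cancels the linear
  part of the exponential tilt.\<close>

lemma centered_gaussian_density_translate:
  assumes "covariance_matrix S" "invertible S"
  shows "centered_gaussian_density S (x + S *v u) * exp (u \<bullet> (x + S *v u))
       = exp (u \<bullet> (S *v u) / 2) * centered_gaussian_density S x"
proof -
  let ?A = "matrix_inv S"
  have AS: "?A *v (S *v y) = y" and SA: "S *v (?A *v y) = y" for y
    by (simp_all add: matrix_vector_mul_assoc matrix_inv_inverse[OF assms(2)])
  have "(x + S *v u) \<bullet> (?A *v (x + S *v u)) = x \<bullet> (?A *v x) + 2 * (u \<bullet> x) + u \<bullet> (S *v u)"
    by (simp add: matrix_vector_right_distrib AS SA inner_add_left inner_add_right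
        covariance_matrix_symmetric[OF assms(1)] inner_commute[of x u])
  then show ?thesis
    unfolding centered_gaussian_density_def
    by (simp add: inner_add_right field_simps flip: exp_add)
qed

lemma gaussian_mgf:
  fixes X :: "'a \<Rightarrow> real ^ 'd"
  assumes "prob_space M" "covariance_matrix S" "invertible S"
    and X: "distributed M lborel X (\<lambda>x. ennreal (centered_gaussian_density S x))"
  shows "(\<integral>\<^sup>+\<omega>. ennreal (exp (u \<bullet> X \<omega>)) \<partial>M) = ennreal (exp (u \<bullet> (S *v u) / 2))"
proof -
  interpret prob_space M by fact
  let ?p = "\<lambda>x. ennreal (centered_gaussian_density S x)"
  have [measurable]: "?p \<in> borel_measurable borel"
    using distributed_borel_measurable[OF X] by simp
  \<comment> \<open>The normalisation is read off from \<open>M\<close> being a probability measure,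
    instead of evaluating the Gaussian integral.\<close>
  have mass: "(\<integral>\<^sup>+x. ?p x \<partial>lborel) = 1"
    using distributed_nn_integral[OF X, of "\<lambda>_. 1"] by (simp add: emeasure_space_1)
  have "(\<integral>\<^sup>+\<omega>. ennreal (exp (u \<bullet> X \<omega>)) \<partial>M) = (\<integral>\<^sup>+x. ?p x * ennreal (exp (u \<bullet> x)) \<partial>lborel)"
    by (rule distributed_nn_integral[OF X, symmetric]) simp
  \<comment> \<open>Translation invariance of Lebesgue measure brings in the shift that completes
    the square.\<close>
  also have "\<dots> = (\<integral>\<^sup>+x. ?p x * ennreal (exp (u \<bullet> x)) \<partial>distr lborel borel ((+) (S *v u)))"
    by (simp only: lborel_distr_plus)
  also have "\<dots> = (\<integral>\<^sup>+x. ?p (x + S *v u) * ennreal (exp (u \<bullet> (x + S *v u))) \<partial>lborel)"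
    by (subst nn_integral_distr) (simp_all add: add.commute)
  also have "\<dots> = (\<integral>\<^sup>+x. ennreal (exp (u \<bullet> (S *v u) / 2)) * ?p x \<partial>lborel)"
    by (simp add: centered_gaussian_density_translate[OF assms(2,3)] ennreal_mult' flip: ennreal_mult'')
  also have "\<dots> = ennreal (exp (u \<bullet> (S *v u) / 2))"
    by (simp add: nn_integral_cmult mass)
  finally show ?thesis .
qed

text \<open>A coordinate hyperplane is Lebesgue null, and a law with a density inherits this. It
  excludes the points where \<open>gamma_mixture\<close> fails.\<close>

lemma gaussian_AE_nonzero:
  fixes X :: "'a \<Rightarrow> real ^ 'd"
  assumes X: "distributed M lborel X f"
  shows "AE \<omega> in M. X \<omega> $ j \<noteq> 0"
proof -
  have [measurable]: "X \<in> measurable M lborel"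
    using X by (rule distributed_measurable)
  have [measurable]: "f \<in> borel_measurable lborel"
    using X by (rule distributed_borel_measurable)
  have "negligible {x :: real ^ 'd. x $ j = 0}"
    by (rule negligible_standard_hyperplane_cart)
  moreover have "{x :: real ^ 'd. x $ j = 0} \<in> sets lborel"
    by simp
  ultimately have "{x :: real ^ 'd. x $ j = 0} \<in> null_sets lborel"
    by (simp add: negligible_iff_null_sets null_sets_completion_iff)
  then have "AE x in lborel. (x :: real ^ 'd) $ j \<noteq> 0"
    by (rule AE_I') auto
  then have "AE x in density lborel f. x $ j \<noteq> 0"
    by (subst AE_density) auto
  then show ?thesis
    unfolding distributed_distr_eq_density[OF X, symmetric]
    by (subst (asm) AE_distr_iff[OF distributed_measurable[OF X]]) simp_all
qed

section \<open>Gaussian kernels and negative powers as mixtures\<close>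

text \<open>Under the product measure the expectation of the complex exponential factors into
  standard normal characteristic functions, which are themselves Gaussian kernels; real parts give
  the cosine.\<close>

lemma integral_cos_normal_product:
  fixes r x :: "'d :: finite \<Rightarrow> real"
  shows "(\<integral>z. cos (\<Sum>j\<in>J. r j * z j * x j) \<partial>Pi\<^sub>M J (\<lambda>_. std_normal_distribution))
       = (\<Prod>j\<in>J. exp (- ((r j * x j)\<^sup>2 / 2)))"
proof -
  interpret N: prob_space std_normal_distribution
    by (simp add: prob_space_normal_density)
  interpret P: product_prob_space "\<lambda>_::'d. std_normal_distribution" J
    by standard
  let ?P = "Pi\<^sub>M J (\<lambda>_. std_normal_distribution)"
  let ?e = "\<lambda>z. \<Prod>j\<in>J. iexp (r j * x j * z j)"
  have e: "?e z = iexp (\<Sum>j\<in>J. r j * z j * x j)" for z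
    by (simp add: exp_sum sum_distrib_left ac_simps)
  have "(\<integral>z. ?e z \<partial>?P) = (\<Prod>j\<in>J. char std_normal_distribution (r j * x j))"
    unfolding char_def
    by (rule P.product_integral_prod)
      (auto intro!: N.integrable_const_bound[where B = 1])
  also have "\<dots> = of_real (\<Prod>j\<in>J. exp (- ((r j * x j)\<^sup>2 / 2)))"
    by (simp add: char_std_normal_distribution)
  finally have "Re (\<integral>z. ?e z \<partial>?P) = (\<Prod>j\<in>J. exp (- ((r j * x j)\<^sup>2 / 2)))"
    by (simp only: Re_complex_of_real)
  moreover have "integrable ?P ?e"
    unfolding e by (rule P.integrable_const_bound[where B = 1]) auto
  then have "Re (\<integral>z. ?e z \<partial>?P) = (\<integral>z. Re (?e z) \<partial>?P)"
    by simp
  ultimately show ?thesis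
    unfolding e by (simp add: Re_exp)
qed

text \<open>The integrand of the Gamma integral at \<open>a / 2\<close> without its factor
  \<open>exp (- t)\<close>, divided by the value of that integral. The halved exponent compensates
  for the square in \<open>exp (- t * x\<^sup>2)\<close>.\<close>

definition gamma_weight :: "real \<Rightarrow> real \<Rightarrow> real" where
  "gamma_weight a t = indicator {0..} t * t powr (a / 2 - 1) / Gamma (a / 2)"

text \<open>Rescaling the variable of the Gamma integral by \<open>x\<^sup>2\<close>, which is
  positive as \<open>x \<noteq> 0\<close>, extracts the factor
  \<open>\<bar>x\<bar> powr a\<close>.\<close>

lemma gamma_mixture:
  fixes x a :: real
  assumes "x \<noteq> 0" "a > 0"
  shows "(\<integral>\<^sup>+t. ennreal (gamma_weight a t * exp (- t * x\<^sup>2)) \<partial>lborel) = ennreal (\<bar>x\<bar> powr (- a))"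
proof -
  let ?f = "\<lambda>t. ennreal (indicator {0..} t * t powr (a / 2 - 1) * exp (- t * x\<^sup>2))"
  have x: "x\<^sup>2 > 0" using assms by simp
  have "ennreal (Gamma (a / 2)) = (\<integral>\<^sup>+t. ennreal (indicator {0..} t * t powr (a / 2 - 1) / exp t) \<partial>lborel)"
    by (rule Gamma_conv_nn_integral_real) (use assms in simp)
  also have "\<dots> = ennreal (x\<^sup>2) * (\<integral>\<^sup>+t. ennreal (indicator {0..} (x\<^sup>2 * t) * (x\<^sup>2 * t) powr (a / 2 - 1) / exp (x\<^sup>2 * t)) \<partial>lborel)"
    by (subst nn_integral_real_affine[where c = "x\<^sup>2" and t = 0]) (use x in auto)
  also have "\<dots> = (\<integral>\<^sup>+t. ennreal (\<bar>x\<bar> powr a) * ?f t \<partial>lborel)"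
  proof (subst nn_integral_cmult[symmetric], simp, intro nn_integral_cong)
    fix t :: real
    have "x\<^sup>2 * (x\<^sup>2 * t) powr (a / 2 - 1) = \<bar>x\<bar> powr a * t powr (a / 2 - 1)" if "t \<ge> 0"
    proof -
      \<comment> \<open>The Jacobian \<open>x\<^sup>2\<close> raises the exponent
        \<open>a / 2 - 1\<close> to \<open>a / 2\<close>.\<close>
      have "x\<^sup>2 * (x\<^sup>2) powr (a / 2 - 1) = (x\<^sup>2) powr (1 + (a / 2 - 1))"
        using x by (simp only: powr_add powr_one)
      also have "\<dots> = (\<bar>x\<bar> powr 2) powr (a / 2)"
        by simp
      also have "\<dots> = \<bar>x\<bar> powr a"
        by (simp only: powr_powr) simp
      finally show ?thesis
        using that by (simp add: powr_mult)
    qed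
    moreover have "(0 \<le> x\<^sup>2 * t) = (0 \<le> t)"
      using x by (simp add: zero_le_mult_iff)
    ultimately show "ennreal (x\<^sup>2) * ennreal (indicator {0..} (x\<^sup>2 * t) * (x\<^sup>2 * t) powr (a / 2 - 1) / exp (x\<^sup>2 * t))
        = ennreal (\<bar>x\<bar> powr a) * ?f t"
      by (auto simp: indicator_def exp_minus field_simps simp flip: ennreal_mult')
  qed
  also have "\<dots> = ennreal (\<bar>x\<bar> powr a) * (\<integral>\<^sup>+t. ?f t \<partial>lborel)"
    by (simp add: nn_integral_cmult)
  finally have gamma: "ennreal (Gamma (a / 2)) = ennreal (\<bar>x\<bar> powr a) * (\<integral>\<^sup>+t. ?f t \<partial>lborel)" .
  \<comment> \<open>Writing \<open>1 / Gamma (a / 2)\<close> as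
    \<open>?c * \<bar>x\<bar> powr a\<close> lets \<open>gamma\<close> be substituted without
    dividing in \<open>ennreal\<close>.\<close>
  let ?c = "\<bar>x\<bar> powr (- a) / Gamma (a / 2)"
  have G: "Gamma (a / 2) > 0" using assms by (simp add: Gamma_real_pos)
  have "(\<integral>\<^sup>+t. ennreal (gamma_weight a t * exp (- t * x\<^sup>2)) \<partial>lborel)
      = (\<integral>\<^sup>+t. ennreal (1 / Gamma (a / 2)) * ?f t \<partial>lborel)"
    using G by (intro nn_integral_cong) (simp add: gamma_weight_def field_simps flip: ennreal_mult')
  also have "\<dots> = ennreal (1 / Gamma (a / 2)) * (\<integral>\<^sup>+t. ?f t \<partial>lborel)"
    by (rule nn_integral_cmult) simp
  also have "1 / Gamma (a / 2) = ?c * \<bar>x\<bar> powr a"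
    using assms by (simp add: powr_minus)
  also have "ennreal (?c * \<bar>x\<bar> powr a) * (\<integral>\<^sup>+t. ?f t \<partial>lborel) = ennreal ?c * ennreal (Gamma (a / 2))"
    unfolding gamma using G by (subst ennreal_mult) (simp_all add: mult.assoc)
  also have "\<dots> = ennreal (\<bar>x\<bar> powr (- a))"
    using G by (simp flip: ennreal_mult)
  finally show ?thesis .
qed

section \<open>Correlation of cosines of linear forms\<close>

text \<open>Reduction to one dimension: \<open>gaussian_mgf\<close> at \<open>s *\<^sub>R u\<close>
  shows that \<open>u \<bullet> X\<close> has the exponential moments of a centered normal variable
  with variance \<open>u \<bullet> (S *v u)\<close>.\<close>

lemma gaussian_expectation_cos:
  fixes X :: "'a \<Rightarrow> real ^ 'd"
  assumes "prob_space M" "covariance_matrix S" "invertible S"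
    and X: "distributed M lborel X (\<lambda>x. ennreal (centered_gaussian_density S x))"
  shows "(\<integral>\<omega>. cos (u \<bullet> X \<omega>) \<partial>M) = exp (- (u \<bullet> (S *v u)) / 2)"
proof (rule expectation_cos_of_gaussian_mgf)
  have [measurable]: "X \<in> borel_measurable M"
    using distributed_measurable[OF X] by simp
  show "(\<lambda>\<omega>. u \<bullet> X \<omega>) \<in> borel_measurable M" by simp
  fix s :: real
  have mgf: "(\<integral>\<^sup>+\<omega>. ennreal (exp (s * (u \<bullet> X \<omega>))) \<partial>M) = ennreal (exp (u \<bullet> (S *v u) * s\<^sup>2 / 2))"
    using gaussian_mgf[OF assms, of "s *\<^sub>R u"]
    by (simp add: matrix_vector_mult_scaleR power2_eq_square mult_ac)
  then show "integrable M (\<lambda>\<omega>. exp (s * (u \<bullet> X \<omega>)))"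
    by (intro integrableI_nonneg) auto
  show "(\<integral>\<omega>. exp (s * (u \<bullet> X \<omega>)) \<partial>M) = exp (u \<bullet> (S *v u) * s\<^sup>2 / 2)"
    by (subst integral_eq_nn_integral) (simp_all add: mgf)
qed

lemma gaussian_cos_correlation:
  fixes X :: "'a \<Rightarrow> real ^ 'd"
  assumes "prob_space M" "covariance_matrix S" "invertible S"
    and X: "distributed M lborel X (\<lambda>x. ennreal (centered_gaussian_density S x))"
  shows "(\<integral>\<omega>. cos (u \<bullet> X \<omega>) \<partial>M) * (\<integral>\<omega>. cos (v \<bullet> X \<omega>) \<partial>M)
       \<le> (\<integral>\<omega>. cos (u \<bullet> X \<omega>) * cos (v \<bullet> X \<omega>) \<partial>M)"
proof -
  interpret prob_space M by fact
  have [measurable]: "X \<in> borel_measurable M"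
    using distributed_measurable[OF X] by simp
  have int: "integrable M (\<lambda>\<omega>. cos (w \<bullet> X \<omega>))" for w
    by (rule integrable_const_bound[where B = 1]) auto
  let ?Q = "\<lambda>w. w \<bullet> (S *v w)" and ?c = "u \<bullet> (S *v v)"
  have sym: "v \<bullet> (S *v u) = ?c"
    by (metis assms(2) covariance_matrix_symmetric inner_commute)
  \<comment> \<open>The two forms differ only in the sign of the cross term, so averaging their
    exponentials produces \<open>cosh ?c\<close>.\<close>
  have Q: "?Q (u + v) = ?Q u + ?Q v + 2 * ?c" "?Q (u - v) = ?Q u + ?Q v - 2 * ?c"
    by (simp_all add: matrix_vector_right_distrib matrix_vector_mult_diff_distrib
        inner_add_left inner_add_right inner_diff_left inner_diff_right sym)
  have "(\<integral>\<omega>. cos (u \<bullet> X \<omega>) * cos (v \<bullet> X \<omega>) \<partial>M)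
      = (\<integral>\<omega>. (cos ((u - v) \<bullet> X \<omega>) + cos ((u + v) \<bullet> X \<omega>)) / 2 \<partial>M)"
    by (simp add: cos_times_cos inner_add_left inner_diff_left)
  also have "\<dots> = (exp (- ?Q (u - v) / 2) + exp (- ?Q (u + v) / 2)) / 2"
    by (simp add: int gaussian_expectation_cos[OF assms])
  also have "\<dots> = exp (- ?Q u / 2) * exp (- ?Q v / 2) * cosh ?c"
    unfolding Q cosh_field_def by (simp add: field_simps flip: exp_add)
  also have "\<dots> \<ge> exp (- ?Q u / 2) * exp (- ?Q v / 2) * 1"
    by (intro mult_left_mono cosh_real_ge_1) auto
  finally show ?thesis
    by (simp add: gaussian_expectation_cos[OF assms])
qed

section \<open>From cosines to Gaussian kernels and negative powers\<close>

lemma gaussian_kernel_correlation: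
  fixes X :: "'a \<Rightarrow> real ^ 'd" and r q :: "'d \<Rightarrow> real"
  assumes "prob_space M" "covariance_matrix S" "invertible S"
    and X: "distributed M lborel X (\<lambda>x. ennreal (centered_gaussian_density S x))"
  shows "(\<integral>\<omega>. (\<Prod>j\<in>I. exp (- ((r j * X \<omega> $ j)\<^sup>2 / 2))) \<partial>M) * (\<integral>\<omega>. (\<Prod>j\<in>J. exp (- ((q j * X \<omega> $ j)\<^sup>2 / 2))) \<partial>M)
       \<le> (\<integral>\<omega>. (\<Prod>j\<in>I. exp (- ((r j * X \<omega> $ j)\<^sup>2 / 2))) * (\<Prod>j\<in>J. exp (- ((q j * X \<omega> $ j)\<^sup>2 / 2))) \<partial>M)"
proof -
  have [measurable]: "X \<in> borel_measurable M"
    using distributed_measurable[OF X] by simp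
  let ?N = "\<lambda>K. Pi\<^sub>M K (\<lambda>_::'d. std_normal_distribution)"
  let ?E = "\<lambda>K p \<omega>. \<Prod>j\<in>K. exp (- ((p j * X \<omega> $ j)\<^sup>2 / 2))"
  have N: "prob_space (?N K)" for K
    by (rule prob_space_PiM) (simp add: prob_space_normal_density)
  define c where "c K p z \<omega> = cos (\<Sum>j\<in>K. p j * z j * X \<omega> $ j)" for K p z \<omega>
  have c_meas: "(\<lambda>(z, \<omega>). c K p z \<omega>) \<in> borel_measurable (?N K \<Otimes>\<^sub>M M)" for K and p :: "'d \<Rightarrow> real"
    unfolding c_def by measurable
  \<comment> \<open>Padding the coefficients by zero outside \<open>K\<close> makes the partial sum
    an inner product with \<open>X \<omega>\<close>, to which the cosine inequality applies.\<close>
  have c: "c K p z \<omega> = cos ((\<chi> j. if j \<in> K then p j * z j else 0) \<bullet> X \<omega>)" for K p z \<omega>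
    unfolding c_def inner_vec_def by (simp add: if_distrib[of "\<lambda>y. y * _"] sum.If_cases cong: if_cong)
  have E: "(\<integral>z. c K p z \<omega> \<partial>?N K) = ?E K p \<omega>" for K p \<omega>
    unfolding c_def by (rule integral_cos_normal_product)
  have E_bound: "\<bar>?E K p \<omega>\<bar> \<le> 1" for K p \<omega>
    by (simp add: abs_prod prod_le_1)
  \<comment> \<open>First averaging: one cosine is kept as the fixed factor while the other becomes
    a kernel. The second averaging then fixes that kernel and treats the remaining cosine.\<close>
  have cos_E: "(\<integral>\<omega>. cos (v \<bullet> X \<omega>) \<partial>M) * (\<integral>\<omega>. ?E I r \<omega> \<partial>M) \<le> (\<integral>\<omega>. cos (v \<bullet> X \<omega>) * ?E I r \<omega> \<partial>M)" for v
    using mixture_correlation[OF N assms(1) c_meas, of "\<lambda>\<omega>. cos (v \<bullet> X \<omega>)" I r]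
      gaussian_cos_correlation[OF assms]
    unfolding E by (simp add: c mult.commute)
  have "(\<integral>\<omega>. ?E J q \<omega> \<partial>M) * (\<integral>\<omega>. ?E I r \<omega> \<partial>M) \<le> (\<integral>\<omega>. ?E J q \<omega> * ?E I r \<omega> \<partial>M)"
    unfolding E[where K = J and p = q, symmetric]
    by (rule mixture_correlation[OF N assms(1) c_meas])
      (use cos_E E_bound in \<open>simp_all add: c\<close>)
  then show ?thesis by (simp add: mult.commute)
qed

lemma gamma_weight_nonneg: "a > 0 \<Longrightarrow> 0 \<le> gamma_weight a t"
  by (simp add: gamma_weight_def Gamma_real_pos less_imp_le)

lemma measurable_gamma_weight [measurable]: "gamma_weight a \<in> borel_measurable borel"
  unfolding gamma_weight_def by measurable

text \<open>The scale \<open>r j = sqrt (2 * t j)\<close> turns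
  \<open>exp (- t j * x\<^sup>2)\<close> into the kernel already treated; the nonnegative weights do
  not depend on \<open>\<omega>\<close> and come out of the integrals.\<close>

lemma gaussian_weighted_kernel_correlation:
  fixes X :: "'a \<Rightarrow> real ^ 'd" and a s t :: "'d \<Rightarrow> real"
  assumes "prob_space M" "covariance_matrix S" "invertible S"
    and X: "distributed M lborel X (\<lambda>x. ennreal (centered_gaussian_density S x))"
    and a: "\<And>j. a j > 0"
  defines "k \<equiv> \<lambda>K t \<omega>. \<Prod>j\<in>K. ennreal (gamma_weight (a j) (t j) * exp (- t j * (X \<omega> $ j)\<^sup>2))"
  shows "(\<integral>\<^sup>+\<omega>. k I s \<omega> \<partial>M) * (\<integral>\<^sup>+\<omega>. k J t \<omega> \<partial>M) \<le> (\<integral>\<^sup>+\<omega>. k I s \<omega> * k J t \<omega> \<partial>M)"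
proof -
  interpret prob_space M by fact
  have [measurable]: "X \<in> borel_measurable M"
    using distributed_measurable[OF X] by simp
  let ?W = "\<lambda>K t. \<Prod>j\<in>K. gamma_weight (a j) (t j)"
  let ?E = "\<lambda>K t \<omega>. \<Prod>j\<in>K. exp (- ((sqrt (2 * t j) * X \<omega> $ j)\<^sup>2 / 2))"
  have W: "?W K t \<ge> 0" for K t
    by (intro prod_nonneg gamma_weight_nonneg a)
  have E: "0 \<le> ?E K t \<omega>" "?E K t \<omega> \<le> 1" for K t \<omega>
    by (simp_all add: prod_nonneg prod_le_1)
  have k: "k K t \<omega> = ennreal (?W K t * ?E K t \<omega>)" for K t \<omega>
  proof -
    \<comment> \<open>For negative \<open>t j\<close> the exponentials may differ, but the indicator
      in \<open>gamma_weight\<close> makes both sides zero.\<close>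
    have "gamma_weight (a j) (t j) * exp (- t j * (X \<omega> $ j)\<^sup>2)
        = gamma_weight (a j) (t j) * exp (- ((sqrt (2 * t j) * X \<omega> $ j)\<^sup>2 / 2))" for j
      by (cases "t j \<ge> 0") (auto simp: gamma_weight_def power_mult_distrib)
    then show ?thesis
      unfolding k_def prod.distrib[symmetric]
      by (subst prod_ennreal) (simp_all only: gamma_weight_nonneg a mult_nonneg_nonneg exp_ge_zero)
  qed
  have int: "integrable M (?E K t)" "integrable M (\<lambda>\<omega>. ?E K t \<omega> * ?E L p \<omega>)" for K L t p
    using E by (auto intro!: integrable_const_bound[where B = 1] AE_I2 mult_le_one simp: abs_mult)
  have "(\<integral>\<^sup>+\<omega>. k K t \<omega> \<partial>M) = ennreal (?W K t * (\<integral>\<omega>. ?E K t \<omega> \<partial>M))" for K t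
    unfolding k using W E int by (subst nn_integral_eq_integral) auto
  moreover have "(\<integral>\<^sup>+\<omega>. k I s \<omega> * k J t \<omega> \<partial>M)
      = ennreal (?W I s * ?W J t * (\<integral>\<omega>. ?E I s \<omega> * ?E J t \<omega> \<partial>M))"
  proof -
    have "k I s \<omega> * k J t \<omega> = ennreal (?W I s * ?W J t * (?E I s \<omega> * ?E J t \<omega>))" for \<omega>
      unfolding k using W E by (simp add: mult_ac flip: ennreal_mult)
    then show ?thesis
      using W E int by (simp add: nn_integral_eq_integral)
  qed
  moreover have "?W I s * ?W J t * ((\<integral>\<omega>. ?E I s \<omega> \<partial>M) * (\<integral>\<omega>. ?E J t \<omega> \<partial>M))
      \<le> ?W I s * ?W J t * (\<integral>\<omega>. ?E I s \<omega> * ?E J t \<omega> \<partial>M)"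
    using W by (intro mult_left_mono gaussian_kernel_correlation[OF assms(1-4)]) auto
  ultimately show ?thesis
    using W E by (simp add: mult_ac flip: ennreal_mult')
qed

text \<open>Both parameter vectors of the weighted kernels are integrated out, one after the other.
  Working in \<open>ennreal\<close> allows infinite moments.\<close>

lemma gaussian_negative_moments_correlation:
  fixes X :: "'a \<Rightarrow> real ^ 'd" and a :: "'d \<Rightarrow> real"
  assumes "prob_space M" "covariance_matrix S" "invertible S"
    and X: "distributed M lborel X (\<lambda>x. ennreal (centered_gaussian_density S x))"
    and a: "\<And>j. a j > 0"
  defines "m \<equiv> \<lambda>K \<omega>. ennreal (\<Prod>j\<in>K. \<bar>X \<omega> $ j\<bar> powr (- a j))"
  shows "(\<integral>\<^sup>+\<omega>. m I \<omega> \<partial>M) * (\<integral>\<^sup>+\<omega>. m J \<omega> \<partial>M) \<le> (\<integral>\<^sup>+\<omega>. m I \<omega> * m J \<omega> \<partial>M)"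
proof -
  interpret prob_space M by fact
  interpret L: product_sigma_finite "\<lambda>_::'d. lborel :: real measure"
    by standard
  have [measurable]: "X \<in> borel_measurable M"
    using distributed_measurable[OF X] by simp
  let ?N = "\<lambda>K. Pi\<^sub>M K (\<lambda>_::'d. lborel :: real measure)"
  define k where "k K t \<omega> = (\<Prod>j\<in>K. ennreal (gamma_weight (a j) (t j) * exp (- t j * (X \<omega> $ j)\<^sup>2)))"
    for K t \<omega>
  define f where "f K \<omega> = (\<integral>\<^sup>+t. k K t \<omega> \<partial>?N K)" for K \<omega>
  have N: "sigma_finite_measure (?N K)" for K
    by (rule L.sigma_finite) simp
  have M: "sigma_finite_measure M" by standard
  have k_meas: "(\<lambda>(t, \<omega>). k K t \<omega>) \<in> borel_measurable (?N K \<Otimes>\<^sub>M M)" for K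
    unfolding k_def by measurable
  have k_meas' [measurable]: "k K t \<in> borel_measurable M" for K t
    unfolding k_def by measurable
  \<comment> \<open>The integral over the product Lebesgue measure splits into one Gamma integral
    per coordinate.\<close>
  have f_prod: "f K \<omega> = (\<Prod>j\<in>K. \<integral>\<^sup>+t. ennreal (gamma_weight (a j) t * exp (- t * (X \<omega> $ j)\<^sup>2)) \<partial>lborel)" for K \<omega>
    unfolding f_def k_def by (rule L.product_nn_integral_prod) auto
  have f_meas [measurable]: "f K \<in> borel_measurable M" for K
    unfolding f_prod by measurable
  have k_k: "(\<integral>\<^sup>+\<omega>. k I s \<omega> \<partial>M) * (\<integral>\<^sup>+\<omega>. k J t \<omega> \<partial>M) \<le> (\<integral>\<^sup>+\<omega>. k I s \<omega> * k J t \<omega> \<partial>M)" for s t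
    unfolding k_def using a by (rule gaussian_weighted_kernel_correlation[OF assms(1-4)])
  \<comment> \<open>As with the cosines, one factor is averaged while the other is held at a fixed
    \<open>t\<close>; commutativity then exchanges their roles.\<close>
  have f_k: "(\<integral>\<^sup>+\<omega>. k J t \<omega> \<partial>M) * (\<integral>\<^sup>+\<omega>. f I \<omega> \<partial>M) \<le> (\<integral>\<^sup>+\<omega>. k J t \<omega> * f I \<omega> \<partial>M)" for t
    using mixture_correlation_nn[OF N M k_meas k_meas' k_k]
    unfolding f_def by (simp add: mult.commute)
  have "(\<integral>\<^sup>+\<omega>. f J \<omega> \<partial>M) * (\<integral>\<^sup>+\<omega>. f I \<omega> \<partial>M) \<le> (\<integral>\<^sup>+\<omega>. f J \<omega> * f I \<omega> \<partial>M)"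
    unfolding f_def[of J] by (rule mixture_correlation_nn[OF N M k_meas f_meas f_k])
  moreover \<comment> \<open>only almost everywhere: at \<open>0\<close> the Gamma integral is infinite, while \<open>0 powr _ = 0\<close>\<close>
  have f_m: "AE \<omega> in M. f K \<omega> = m K \<omega>" for K
  proof -
    have "AE \<omega> in M. \<forall>j. X \<omega> $ j \<noteq> 0"
      using gaussian_AE_nonzero[OF X] by (simp add: AE_all_countable)
    then show ?thesis
    proof eventually_elim
      case (elim \<omega>)
      then have "f K \<omega> = (\<Prod>j\<in>K. ennreal (\<bar>X \<omega> $ j\<bar> powr (- a j)))"
        unfolding f_prod by (intro prod.cong refl gamma_mixture a) auto
      then show ?case
        by (simp add: m_def prod_ennreal)
    qed
  qed
  have "(\<integral>\<^sup>+\<omega>. f K \<omega> \<partial>M) = (\<integral>\<^sup>+\<omega>. m K \<omega> \<partial>M)" for K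
    by (rule nn_integral_cong_AE) (rule f_m)
  moreover have "(\<integral>\<^sup>+\<omega>. f J \<omega> * f I \<omega> \<partial>M) = (\<integral>\<^sup>+\<omega>. m J \<omega> * m I \<omega> \<partial>M)"
    by (rule nn_integral_cong_AE) (use f_m[of I] f_m[of J] in eventually_elim, simp)
  ultimately show ?thesis
    by (simp add: mult.commute)
qed

theorem proposition4p1:
  fixes M :: "'a measure"
    and S :: "real ^ 'd ^ 'd"
    and X :: "'a \<Rightarrow> real ^ 'd"
    and n :: "'d \<Rightarrow> real"
    and I :: "'d set"
  assumes "prob_space M"
    and "covariance_matrix S" and "invertible S"
    and "distributed M lborel X (\<lambda>x. ennreal (centered_gaussian_density S x))"
    and "\<And>j. 0 < n j \<and> n j < 1"
  shows "(\<integral>\<^sup>+ \<omega>. ennreal (\<Prod>j\<in>UNIV. \<bar>X \<omega> $ j\<bar> powr (- n j)) \<partial>M)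
       \<ge> (\<integral>\<^sup>+ \<omega>. ennreal (\<Prod>j\<in>I. \<bar>X \<omega> $ j\<bar> powr (- n j)) \<partial>M)
         * (\<integral>\<^sup>+ \<omega>. ennreal (\<Prod>j\<in>- I. \<bar>X \<omega> $ j\<bar> powr (- n j)) \<partial>M)"
proof -
  have "(\<Prod>j\<in>UNIV. \<bar>X \<omega> $ j\<bar> powr (- n j))
      = (\<Prod>j\<in>I. \<bar>X \<omega> $ j\<bar> powr (- n j)) * (\<Prod>j\<in>- I. \<bar>X \<omega> $ j\<bar> powr (- n j))" for \<omega>
    by (subst prod.union_disjoint[symmetric]) auto
  then show ?thesis
    using gaussian_negative_moments_correlation[OF assms(1-4), of n I "- I"] assms(5)
    by (simp add: ennreal_mult prod_nonneg)
qed

end
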